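(* Let $k$ be a non-negative integer. For every positive integer $d$, there exists a tree $T$ such that $\zeta_k(T)>d$.
   Context: Trees are finite. The $k$-visibility Localization game on a finite connected graph $G$ ($k\ge 0$ an integer) with $m$ cops: the robber first chooses a vertex of $G$. Then in each round the cops choose any vertices $u_1,\dots,u_m$ (no restriction relative to earlier placements), and cop $i$ receives the probe $d_i=d(u_i,x)$ if the robber's vertex $x$ satisfies $d(u_i,x)\le k$, and $d_i=\ast$ (no information) otherwise; afterwards the robber moves to a neighboring vertex or stays in place. A candidate is a vertex the robber may occupy, consistent with the information obtained so far. The cops win if they have a strategy that, whatever the robber does, determines after finitely many rounds a unique candidate (the robber is omniscient and knows the cops' entire strategy). The $k$-visibility localization number $\zeta_k(G)$ is the least positive integer $m$ for which $m$ cops have a winning strategy. *)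

theory Defs
  imports "Graph_Theory.Digraph_Component" "Graph_Theory.Shortest_Path"
begin

(* The locale graph describes finite simple graphs as symmetric loop-free digraphs
   without parallel arcs. Digraph_Component.tree is unusable for them: an edge {u,v} gives the
   closed walk u,v,u, which counts as a cycle of length 2. The cycles of length at least 3 are
   exactly the cycles of the undirected graph. Connectedness includes nonemptiness. *)
definition undirected_tree :: "('a, 'b) pre_digraph \<Rightarrow> bool" where
  "undirected_tree G \<longleftrightarrow> graph G \<and> Digraph_Component.connected G \<and>
     \<not> (\<exists>p. pre_digraph.cycle G p \<and> 3 \<le> length p)"

definition gdist :: "('a, 'b) pre_digraph \<Rightarrow> 'a \<Rightarrow> 'a \<Rightarrow> ereal" where
  "gdist G u v = wf_digraph.\<mu> G (\<lambda>_. 1) u v"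

(* None is the answer *, i.e. no information. *)
definition probe :: "nat \<Rightarrow> ('a, 'b) pre_digraph \<Rightarrow> 'a \<Rightarrow> 'a \<Rightarrow> ereal option" where
  "probe k G x u = (if gdist G u x \<le> ereal (real k) then Some (gdist G u x) else None)"

(* Since the robber may stay in place, every finite play extends to an infinite one. *)
definition robber_play :: "('a, 'b) pre_digraph \<Rightarrow> (nat \<Rightarrow> 'a) \<Rightarrow> bool" where
  "robber_play G x \<longleftrightarrow>
     (\<forall>n. x n \<in> verts G) \<and> (\<forall>n. x (Suc n) = x n \<or> x n \<rightarrow>\<^bsub>G\<^esub> x (Suc n))"

(* A strategy maps the answers of all previous rounds to the next placement of the cops. The
   earlier placements need not be an argument, since the strategy recovers them. *)
type_synonym 'a cop_strategy = "ereal option list list \<Rightarrow> 'a list"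

definition valid_strategy :: "('a, 'b) pre_digraph \<Rightarrow> nat \<Rightarrow> 'a cop_strategy \<Rightarrow> bool" where
  "valid_strategy G m S \<longleftrightarrow> (\<forall>h. length (S h) = m \<and> set (S h) \<subseteq> verts G)"

(* The answers received in rounds 0, ..., n - 1 against the robber play x. *)
primrec history :: "nat \<Rightarrow> ('a, 'b) pre_digraph \<Rightarrow> 'a cop_strategy \<Rightarrow> (nat \<Rightarrow> 'a) \<Rightarrow> nat
    \<Rightarrow> ereal option list list" where
  "history k G S x 0 = []"
| "history k G S x (Suc n) =
     history k G S x n @ [map (probe k G (x n)) (S (history k G S x n))]"

(* The candidates right after the probes of round n, before the robber moves. *)
definition candidates :: "nat \<Rightarrow> ('a, 'b) pre_digraph \<Rightarrow> 'a cop_strategy \<Rightarrow> (nat \<Rightarrow> 'a) \<Rightarrow> nat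
    \<Rightarrow> 'a set" where
  "candidates k G S x n =
     {y n | y. robber_play G y \<and> history k G S y (Suc n) = history k G S x (Suc n)}"

(* Strategies are deterministic, so the robber's omniscience amounts to quantifying over all
   robber plays after the strategy has been fixed. *)
definition cops_win :: "nat \<Rightarrow> ('a, 'b) pre_digraph \<Rightarrow> nat \<Rightarrow> bool" where
  "cops_win k G m \<longleftrightarrow>
     (\<exists>S. valid_strategy G m S \<and>
        (\<forall>x. robber_play G x \<longrightarrow> (\<exists>n. is_singleton (candidates k G S x n))))"

definition localization_number :: "nat \<Rightarrow> ('a, 'b) pre_digraph \<Rightarrow> nat" where
  "localization_number k G = (LEAST m. 0 < m \<and> cops_win k G m)"

lemma gdist_eq_0_iff:
  assumes "wf_digraph G" "v \<in> verts G"
  shows "gdist G u v = 0 \<longleftrightarrow> u = v"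
proof -
  interpret wf_digraph G by fact
  have cost: "awalk_cost (\<lambda>_. 1) p = real (length p)" for p
    by (induction p) auto
  have d: "gdist G u v = (INF p\<in>{p. awalk u p v}. ereal (real (length p)))" for u
    by (simp add: gdist_def \<mu>_def cost)
  have "gdist G v v = 0"
  proof (rule antisym)
    have "[] \<in> {p. awalk v p v}" using assms by (simp add: awalk_Nil_iff)
    then show "gdist G v v \<le> 0" unfolding d by (rule INF_lower2) simp
    show "0 \<le> gdist G v v" unfolding d by (rule INF_greatest) simp
  qed
  moreover have "1 \<le> gdist G u v" if "u \<noteq> v"
    unfolding d
  proof (rule INF_greatest)
    fix p assume "p \<in> {p. awalk u p v}"
    then have "p \<noteq> []" using that by (auto simp: awalk_Nil_iff)
    then have "1 \<le> length p" by (cases p) auto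
    then have "1 \<le> real (length p)" by linarith
    then show "1 \<le> ereal (real (length p))" by (simp add: one_ereal_def)
  qed
  ultimately show ?thesis by fastforce
qed

(* The localization number is well defined: one cop on every vertex wins. *)
lemma cops_win_card_verts:
  assumes "graph G"
  shows "cops_win k G (card (verts G))"
proof -
  interpret graph G by fact
  obtain us where us: "set us = verts G" "distinct us"
    using finite_distinct_list[OF finite_verts] by blast
  let ?S = "\<lambda>h. us"
  have "valid_strategy G (card (verts G)) ?S"
    using us by (auto simp: valid_strategy_def distinct_card[symmetric])
  moreover have "candidates k G ?S x 0 = {x 0}" if x: "robber_play G x" for x
  proof -
    have "y 0 = x 0" if y: "robber_play G y" and "map (probe k G (y 0)) us = map (probe k G (x 0)) us"
      for y
    proof -
      have xy: "x 0 \<in> verts G" "y 0 \<in> verts G"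
        using x y by (auto simp: robber_play_def)
      then have "probe k G (y 0) (x 0) = probe k G (x 0) (x 0)"
        using that(2) us(1) by (simp only: map_eq_conv)
      moreover have "gdist G (x 0) (x 0) = 0"
        using xy by (simp add: gdist_eq_0_iff wf_digraph)
      ultimately have "gdist G (x 0) (y 0) = 0"
        by (auto simp: probe_def split: if_splits)
      then show ?thesis using xy by (simp add: gdist_eq_0_iff wf_digraph)
    qed
    with x show ?thesis by (auto simp: candidates_def)
  qed
  ultimately show ?thesis
    unfolding cops_win_def by (metis is_singletonI)
qed

end

theory Submission
  imports Defs "HOL-Real_Asymp.Real_Asymp"
begin

text \<open>
  The robber plays on a deep complete binary tree and is never seen. Let \<open>W\<close> be the set of
  vertices he cannot occupy. In a round \<open>W\<close> loses the vertices of its inner boundary, which the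
  robber can reach, and gains at most \<open>M = d * 4 ^ k\<close> vertices, the total size of the balls of
  radius \<open>k\<close> around the cops. So \<open>W\<close> stays small if the inner boundary has at least \<open>M\<close> vertices
  whenever \<open>s \<le> |W| \<le> s + M\<close>. Such an \<open>s\<close> exists: if \<open>W\<close> has at most \<open>b\<close> boundary edges, then
  \<open>|W|\<close> is determined by whether the root lies in \<open>W\<close> and by the signed numbers of boundary edges
  between consecutive levels. This leaves at most \<open>2 * (2 * h + 1) ^ b\<close> values of \<open>|W|\<close>, so for
  large depth \<open>h\<close> some interval of length \<open>M\<close> below \<open>2 ^ (h + 1)\<close> contains none of them.
\<close>

subsection \<open>Evading a sequence of forbidden sets\<close>

definition evading :: "('a, 'b) pre_digraph \<Rightarrow> (nat \<Rightarrow> 'a set) \<Rightarrow> nat \<Rightarrow> 'a set" where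
  "evading G U n = {y n | y. robber_play G y \<and> (\<forall>i\<le>n. y i \<notin> U i)}"

text \<open>The arc points from outside \<open>W\<close> into \<open>W\<close>: a robber who may be
  anywhere outside \<open>W\<close> can step onto exactly these vertices of \<open>W\<close> in one
  move.\<close>

definition inner_boundary :: "('a, 'b) pre_digraph \<Rightarrow> 'a set \<Rightarrow> 'a set" where
  "inner_boundary G W = {v \<in> W. \<exists>w \<in> verts G - W. w \<rightarrow>\<^bsub>G\<^esub> v}"

lemma evading_subset: "evading G U n \<subseteq> verts G - U n"
  by (auto simp: evading_def robber_play_def)

lemma evading_0: "v \<in> verts G \<Longrightarrow> v \<notin> U 0 \<Longrightarrow> v \<in> evading G U 0"
  by (auto simp: evading_def robber_play_def intro!: exI[of _ "\<lambda>_. v"])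

lemma evading_Suc:
  assumes w: "w \<in> evading G U n" and v: "v \<in> verts G" "v = w \<or> w \<rightarrow>\<^bsub>G\<^esub> v" "v \<notin> U (Suc n)"
  shows "v \<in> evading G U (Suc n)"
proof -
  obtain y where y: "robber_play G y" "\<forall>i\<le>n. y i \<notin> U i" "y n = w"
    using w by (auto simp: evading_def)
  let ?y = "\<lambda>i. if i \<le> n then y i else v"
  have "robber_play G ?y"
    using y v by (auto simp: robber_play_def le_eq_less_or_eq not_less_eq)
  moreover have "\<forall>i\<le>Suc n. ?y i \<notin> U i"
    using y v by (auto simp: le_Suc_eq)
  ultimately show ?thesis
    unfolding evading_def by (smt (verit) mem_Collect_eq not_less_eq_eq order_refl)
qed

lemma evading_play_exists:
  assumes fin: "finite (verts G)" and ne: "\<And>n. evading G U n \<noteq> {}"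
  shows "\<exists>x. robber_play G x \<and> (\<forall>n. x n \<notin> U n)"
proof -
  \<comment> \<open>Koenig's lemma: keep the current vertex one at which arbitrarily long evading plays pass.\<close>
  define A where
    "A n v = {N. n \<le> N \<and> (\<exists>y. robber_play G y \<and> (\<forall>i\<le>N. y i \<notin> U i) \<and> y n = v)}" for n v
  have split: "\<exists>v\<in>V. infinite (A n v)" if "infinite (\<Union>v\<in>V. A n v)" "V \<subseteq> verts G" for n V
    using that fin finite_subset by blast
  have "N \<in> (\<Union>v\<in>verts G. A 0 v)" for N
    using ne[of N] by (auto simp: A_def evading_def robber_play_def)
  then have "(\<Union>v\<in>verts G. A 0 v) = UNIV" by blast
  then have 0: "\<exists>v. infinite (A 0 v)"
    using split[where V = "verts G" and n = 0] by auto
  have step: "\<exists>w. infinite (A (Suc n) w) \<and> (w = v \<or> v \<rightarrow>\<^bsub>G\<^esub> w)" if "infinite (A n v)" for n v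
  proof -
    let ?V = "{w \<in> verts G. w = v \<or> v \<rightarrow>\<^bsub>G\<^esub> w}"
    \<comment> \<open>Only \<open>N = n\<close> can be lost: a play that evades up to some
      \<open>N > n\<close> also has an evading vertex at time \<open>n + 1\<close>.\<close>
    have "A n v - {n} \<subseteq> (\<Union>w\<in>?V. A (Suc n) w)"
    proof
      fix N assume "N \<in> A n v - {n}"
      then obtain y where y: "robber_play G y" "\<forall>i\<le>N. y i \<notin> U i" "y n = v" "n < N"
        by (auto simp: A_def)
      then have "N \<in> A (Suc n) (y (Suc n))" "y (Suc n) \<in> ?V"
        by (auto simp: A_def robber_play_def)
      then show "N \<in> (\<Union>w\<in>?V. A (Suc n) w)" by blast
    qed
    with that have "infinite (\<Union>w\<in>?V. A (Suc n) w)"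
      by (meson finite_Diff2 finite.emptyI finite_insert finite_subset)
    from split[OF this] show ?thesis by auto
  qed
  obtain x where x: "\<And>n. infinite (A n (x n))" "\<And>n. x (Suc n) = x n \<or> x n \<rightarrow>\<^bsub>G\<^esub> x (Suc n)"
    using dependent_nat_choice[of "\<lambda>n v. infinite (A n v)" "\<lambda>n v w. w = v \<or> v \<rightarrow>\<^bsub>G\<^esub> w"] 0 step
    by blast
  have "x n \<in> verts G \<and> x n \<notin> U n" for n
  proof -
    obtain N where "N \<in> A n (x n)"
      using x(1)[of n] by (metis ex_in_conv finite.emptyI)
    then show ?thesis by (auto simp: A_def robber_play_def) metis
  qed
  with x(2) show ?thesis by (auto simp: robber_play_def)
qed

text \<open>If \<open>card W < s\<close>, the at most \<open>M\<close> new vertices cannot lift the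
  size above \<open>s + M\<close>; otherwise, by \<open>iso\<close>, the set \<open>W\<close> loses
  at least \<open>M\<close> vertices and gains at most \<open>M\<close>.\<close>

lemma card_not_evading_le:
  assumes fin: "finite (verts G)"
    and U: "\<And>n. finite (U n)" "\<And>n. card (U n) \<le> M"
    and iso: "\<And>W. W \<subseteq> verts G \<Longrightarrow> s \<le> card W \<Longrightarrow> card W \<le> s + M \<Longrightarrow> M \<le> card (inner_boundary G W)"
  shows "card (verts G - evading G U n) \<le> s + M"
proof (induction n)
  case 0
  have "verts G - evading G U 0 \<subseteq> U 0" using evading_0 by fast
  then have "card (verts G - evading G U 0) \<le> M"
    using U card_mono le_trans by blast
  then show ?case by simp
next
  case (Suc n)
  define W where "W = verts G - evading G U n"
  let ?B = "inner_boundary G W"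
  have finW: "finite W" and WV: "W \<subseteq> verts G" using fin by (auto simp: W_def)
  have BW: "?B \<subseteq> W" by (auto simp: inner_boundary_def)
  have "verts G - evading G U (Suc n) \<subseteq> (W - ?B) \<union> U (Suc n)"
  proof
    fix v assume v: "v \<in> verts G - evading G U (Suc n)"
    show "v \<in> (W - ?B) \<union> U (Suc n)"
    proof (rule ccontr)
      assume n: "v \<notin> (W - ?B) \<union> U (Suc n)"
      then have "\<exists>w\<in>evading G U n. v = w \<or> w \<rightarrow>\<^bsub>G\<^esub> v"
        using v by (auto simp: W_def inner_boundary_def)
      then show False using evading_Suc v n by fast
    qed
  qed
  then have "card (verts G - evading G U (Suc n)) \<le> card ((W - ?B) \<union> U (Suc n))"
    using finW U by (intro card_mono) auto
  also have "\<dots> \<le> card (W - ?B) + M"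
    using card_Un_le[of "W - ?B" "U (Suc n)"] U(2)[of "Suc n"] by linarith
  also have "card (W - ?B) = card W - card ?B"
    using BW finW by (meson card_Diff_subset finite_subset)
  also have "card W - card ?B + M \<le> s + M"
    using iso[OF WV] Suc.IH unfolding W_def[symmetric] by (cases "s \<le> card W") auto
  finally show ?case .
qed

subsection \<open>The unseen robber\<close>

text \<open>A strategy is deterministic, so against a robber who is never seen the placements are
  fixed in advance. Hence \<open>visible\<close> is a sequence of sets that does not depend on the
  play.\<close>

primrec blind_history :: "'a cop_strategy \<Rightarrow> nat \<Rightarrow> ereal option list list" where
  "blind_history S 0 = []"
| "blind_history S (Suc n) = blind_history S n @ [map (\<lambda>_. None) (S (blind_history S n))]"

definition visible :: "nat \<Rightarrow> ('a, 'b) pre_digraph \<Rightarrow> 'a cop_strategy \<Rightarrow> nat \<Rightarrow> 'a set" where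
  "visible k G S n =
     (\<Union>u\<in>set (S (blind_history S n)). {x \<in> verts G. gdist G u x \<le> ereal (real k)})"

lemma history_unseen:
  assumes "robber_play G x" "\<forall>i<n. x i \<notin> visible k G S i"
  shows "history k G S x n = blind_history S n"
  using assms(2)
proof (induction n)
  case (Suc n)
  have "x n \<in> verts G" using assms(1) by (simp add: robber_play_def)
  with Suc show ?case by (auto simp: visible_def probe_def)
qed simp

text \<open>All plays unseen up to round \<open>n\<close> give the same answers, so their positions
  in that round are all candidates against a play \<open>x\<close> that is never seen. By the size
  bound there are at least two such positions in every round.\<close>

lemma not_cops_win_isoperimetric:
  assumes fin: "finite (verts G)"
    and ball: "\<And>u. u \<in> verts G \<Longrightarrow> card {x \<in> verts G. gdist G u x \<le> ereal (real k)} \<le> C"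
    and iso: "\<And>W. W \<subseteq> verts G \<Longrightarrow> s \<le> card W \<Longrightarrow> card W \<le> s + m * C \<Longrightarrow>
      m * C \<le> card (inner_boundary G W)"
    and large: "s + m * C + 2 \<le> card (verts G)"
  shows "\<not> cops_win k G m"
proof
  assume "cops_win k G m"
  then obtain S where S: "valid_strategy G m S"
    and win: "\<And>x. robber_play G x \<Longrightarrow> \<exists>n. is_singleton (candidates k G S x n)"
    by (auto simp: cops_win_def)
  let ?U = "visible k G S"
  have finU: "finite (?U n)" for n
    using fin by (auto simp: visible_def)
  have cardU: "card (?U n) \<le> m * C" for n
  proof -
    let ?us = "set (S (blind_history S n))"
    have us: "?us \<subseteq> verts G" "card ?us \<le> m"
      using S card_length[of "S (blind_history S n)"] by (auto simp: valid_strategy_def)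
    have "card (?U n) \<le> (\<Sum>u\<in>?us. card {x \<in> verts G. gdist G u x \<le> ereal (real k)})"
      unfolding visible_def by (rule card_UN_le) simp
    also have "\<dots> \<le> card ?us * C"
      using sum_bounded_above[of ?us _ C] ball us(1) by (metis (no_types, lifting) of_nat_id subsetD)
    also have "\<dots> \<le> m * C" using us(2) by simp
    finally show ?thesis .
  qed
  have two: "2 \<le> card (evading G ?U n)" for n
  proof -
    have "card (verts G - evading G ?U n) \<le> s + m * C"
      by (rule card_not_evading_le[OF fin finU cardU iso])
    moreover have "evading G ?U n \<subseteq> verts G" using evading_subset by fast
    then have "card (verts G - evading G ?U n) = card (verts G) - card (evading G ?U n)"
      using fin by (meson card_Diff_subset finite_subset)
    ultimately show ?thesis using large by linarith
  qed
  then have "evading G ?U n \<noteq> {}" for n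
    by (metis card.empty not_numeral_le_zero)
  then obtain x where x: "robber_play G x" "\<And>n. x n \<notin> ?U n"
    using evading_play_exists[OF fin] by metis
  obtain n where "is_singleton (candidates k G S x n)" using win[OF x(1)] by blast
  then obtain c where c: "candidates k G S x n = {c}" by (auto simp: is_singleton_def)
  have "evading G ?U n \<subseteq> {c}"
  proof
    fix v assume "v \<in> evading G ?U n"
    then obtain y where y: "robber_play G y" "\<forall>i\<le>n. y i \<notin> ?U i" "v = y n"
      by (auto simp: evading_def)
    have "history k G S y (Suc n) = blind_history S (Suc n)"
      by (rule history_unseen) (use y in auto)
    moreover have "history k G S x (Suc n) = blind_history S (Suc n)"
      by (rule history_unseen) (use x in auto)
    ultimately have "v \<in> candidates k G S x n"
      using y unfolding candidates_def by auto
    then show "v \<in> {c}" using c by simp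
  qed
  then have "card (evading G ?U n) \<le> 1"
    using card_mono[of "{c}"] by simp
  with two[of n] show False by simp
qed

subsection \<open>Cut sets of the complete binary tree\<close>

text \<open>Pigeonhole: each element of \<open>A\<close> lies in one block of \<open>M + 1\<close>
  consecutive numbers, so \<open>A\<close> misses one of the first \<open>q\<close> blocks.\<close>

lemma gap_exists:
  fixes A :: "nat set"
  assumes "finite A" "card A < q"
  obtains s where "s + M < q * (M + 1)" "\<And>a. s \<le> a \<Longrightarrow> a \<le> s + M \<Longrightarrow> a \<notin> A"
proof -
  have "card ((\<lambda>a. a div (M + 1)) ` A) < card {..<q}"
    using assms card_image_le[OF assms(1)] le_less_trans by fastforce
  then have "\<not> {..<q} \<subseteq> (\<lambda>a. a div (M + 1)) ` A"
    using assms(1) card_mono by (metis finite_imageI not_less)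
  then obtain j where j: "j < q" "j \<notin> (\<lambda>a. a div (M + 1)) ` A" by auto
  have "j * (M + 1) + M < Suc j * (M + 1)" by simp
  also have "\<dots> \<le> q * (M + 1)" using j(1) by (intro mult_le_mono1) simp
  finally have 1: "j * (M + 1) + M < q * (M + 1)" .
  have 2: "a \<notin> A" if "j * (M + 1) \<le> a" "a \<le> j * (M + 1) + M" for a
  proof -
    have "a div (M + 1) = j"
      using that by (intro div_nat_eqI) (auto simp: algebra_simps)
    with j(2) show ?thesis by blast
  qed
  from 1 2 show ?thesis by (rule that)
qed

definition bounded_seqs :: "nat \<Rightarrow> nat \<Rightarrow> (nat \<Rightarrow> int) set" where
  "bounded_seqs h b = {c. (\<forall>j\<ge>h. c j = 0) \<and> (\<Sum>j<h. \<bar>c j\<bar>) \<le> int b}"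

lemma bounded_seqs_0: "bounded_seqs h 0 = {\<lambda>_. 0}"
proof -
  have "c = (\<lambda>_. 0)" if c: "\<forall>j\<ge>h. c j = 0" "(\<Sum>j<h. \<bar>c j\<bar>) \<le> 0" for c :: "nat \<Rightarrow> int"
  proof
    fix j
    have "(\<Sum>j<h. \<bar>c j\<bar>) = 0" using c(2) by (intro antisym sum_nonneg) auto
    then show "c j = 0" using c(1) by (cases "j < h") (auto simp: sum_nonneg_eq_0_iff)
  qed
  then show ?thesis by (auto simp: bounded_seqs_def)
qed

text \<open>If the absolute values sum to exactly \<open>b + 1\<close>, some entry is nonzero, and
  moving it one unit towards 0 lowers the sum to \<open>b\<close>.\<close>

lemma bounded_seqs_Suc:
  "bounded_seqs h (Suc b) \<subseteq> bounded_seqs h b \<union>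
     (\<lambda>(c, j, e). c(j := c j + e)) ` (bounded_seqs h b \<times> {..<h} \<times> {-1, 1})"
proof
  fix c assume c: "c \<in> bounded_seqs h (Suc b)"
  show "c \<in> bounded_seqs h b \<union>
     (\<lambda>(c, j, e). c(j := c j + e)) ` (bounded_seqs h b \<times> {..<h} \<times> {-1, 1})"
  proof (cases "c \<in> bounded_seqs h b")
    case False
    then have sum: "(\<Sum>j<h. \<bar>c j\<bar>) = int b + 1" using c by (auto simp: bounded_seqs_def)
    then obtain j where j: "j < h" "c j \<noteq> 0"
      by (metis (no_types, lifting) abs_zero lessThan_iff of_nat_Suc of_nat_eq_0_iff
          add.commute nat.simps(3) sum.neutral)
    define c' where "c' = c(j := c j - sgn (c j))"
    have "(\<Sum>i<h. \<bar>c' i\<bar>) = \<bar>c' j\<bar> + (\<Sum>i\<in>{..<h} - {j}. \<bar>c i\<bar>)"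
      using j by (subst sum.remove[of _ j]) (auto simp: c'_def intro!: sum.cong)
    also have "\<bar>c' j\<bar> = \<bar>c j\<bar> - 1" using j by (auto simp: c'_def sgn_if)
    finally have "(\<Sum>i<h. \<bar>c' i\<bar>) = int b"
      using sum j by (subst (asm) sum.remove[of _ j "\<lambda>i. \<bar>c i\<bar>"]) auto
    then have "c' \<in> bounded_seqs h b"
      using c j by (auto simp: bounded_seqs_def c'_def)
    moreover have "sgn (c j) \<in> {-1, 1}" using j by (auto simp: sgn_if)
    moreover have "c = (\<lambda>(c, j, e). c(j := c j + e)) (c', j, sgn (c j))" by (auto simp: c'_def)
    ultimately show ?thesis using j(1) by (intro UnI2 image_eqI[of _ _ "(c', j, sgn (c j))"]) simp_all
  qed simp
qed

text \<open>Each increase of \<open>b\<close> multiplies the bound by \<open>2 * h + 1\<close>: a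
  sequence is kept, or one of \<open>h\<close> positions and a sign are chosen.\<close>

lemma card_bounded_seqs: "finite (bounded_seqs h b) \<and> card (bounded_seqs h b) \<le> (2 * h + 1) ^ b"
proof (induction b)
  case (Suc b)
  let ?X = "bounded_seqs h b" and ?I = "{..<h} \<times> {-1, 1 :: int}"
  let ?f = "\<lambda>(c, j, e). c(j := c j + e :: int)"
  have fin: "finite (?X \<union> ?f ` (?X \<times> ?I))" using Suc by auto
  have "card (bounded_seqs h (Suc b)) \<le> card (?X \<union> ?f ` (?X \<times> ?I))"
    by (rule card_mono[OF fin bounded_seqs_Suc])
  also have "\<dots> \<le> card ?X + card (?f ` (?X \<times> ?I))" by (rule card_Un_le)
  also have "card (?f ` (?X \<times> ?I)) \<le> card (?X \<times> ?I)"
    using Suc by (intro card_image_le) auto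
  also have "card (?X \<times> ?I) = card ?X * (h * 2)" by (simp add: card_cartesian_product)
  also have "card ?X + card ?X * (h * 2) = (2 * h + 1) * card ?X" by (simp add: algebra_simps)
  also have "\<dots> \<le> (2 * h + 1) ^ Suc b"
    using Suc unfolding power_Suc by (intro mult_le_mono2) simp
  finally show ?case using finite_subset[OF bounded_seqs_Suc fin] by simp
qed (simp add: bounded_seqs_0)

text \<open>The number of vertices of \<open>W\<close> in level \<open>j + 1\<close> is twice that in level \<open>j\<close>, corrected by
  the signed number \<open>c j\<close> of boundary edges between these levels.\<close>
primrec level_size :: "int \<Rightarrow> (nat \<Rightarrow> int) \<Rightarrow> nat \<Rightarrow> int" where
  "level_size a c 0 = a"
| "level_size a c (Suc j) = 2 * level_size a c j + c j"

text \<open>An edge is represented by its lower end \<open>v\<close>, so this is the edge boundary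
  of \<open>W\<close>; the root 1 represents no edge.\<close>

definition cut :: "nat \<Rightarrow> nat set \<Rightarrow> nat set" where
  "cut h W = {v \<in> {2..<2 ^ (h + 1)}. (v \<in> W) \<noteq> (v div 2 \<in> W)}"

lemma sum_halves: "n \<le> m \<Longrightarrow> (\<Sum>v = 2 * n..<2 * m. g (v div 2)) = 2 * (\<Sum>v = n..<m. g v :: int)"
  for n m :: nat
  by (induction m rule: dec_induct) auto

text \<open>The blocks are the levels of the tree. The start \<open>i\<close> is left free:
  \<open>i = 0\<close> serves to sum over all vertices, \<open>i = 1\<close> over all but the root,
  that is, over the edges.\<close>

lemma sum_levels:
  "(\<Sum>v = 2 ^ i..<2 ^ (i + n). g v) = (\<Sum>j<n. \<Sum>v = 2 ^ (i + j)..<2 ^ (i + j + 1). g v :: int)"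
  for i n :: nat and g :: "nat \<Rightarrow> int"
proof (induction n)
  case (Suc n)
  have "(\<Sum>v = 2 ^ i..<2 ^ (i + Suc n). g v)
      = (\<Sum>v = 2 ^ i..<2 ^ (i + n). g v) + (\<Sum>v = 2 ^ (i + n)..<2 ^ (i + n + 1). g v)"
    by (subst sum.atLeastLessThan_concat) (auto intro: power_increasing)
  with Suc show ?case by simp
qed simp

text \<open>Summing over a level the value of \<open>f\<close> at the parent gives twice the sum
  over the level above; the error is \<open>c j\<close>. Edges of opposite sign may cancel in
  \<open>c j\<close>, so the absolute values of the \<open>c j\<close> sum to at most the size of
  the cut.\<close>

lemma card_levels_of_cut:
  assumes W: "W \<subseteq> {1..<2 ^ (h + 1)}" and b: "card (cut h W) \<le> b"
  shows "int (card W) \<in>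
    (\<lambda>(a, c). \<Sum>j<h + 1. level_size a c j) ` ({0, 1} \<times> bounded_seqs h b)"
proof -
  define f where "f v = (of_bool (v \<in> W) :: int)" for v
  define c where "c j = (if j < h then \<Sum>v = 2 ^ (j + 1)..<2 ^ (j + 2). f v - f (v div 2) else 0)" for j
  have lev: "(\<Sum>v = 2 ^ j..<2 ^ (j + 1). f v) = level_size (f 1) c j" if "j \<le> h" for j
    using that
  proof (induction j)
    case 0
    have "{Suc 0..<2} = {1}" by auto
    then show ?case by simp
  next
    case (Suc j)
    have "(\<Sum>v = 2 ^ (j + 1)..<2 ^ (j + 2). f (v div 2)) = 2 * (\<Sum>v = 2 ^ j..<2 ^ (j + 1). f v)"
      using sum_halves[of "2 ^ j" "2 ^ (j + 1)" f] by simp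
    with Suc show ?case by (simp add: c_def sum_subtractf)
  qed
  have "int (card W) = (\<Sum>v = 1..<2 ^ (h + 1). f v)"
    using W by (simp add: f_def Int_absorb1 of_bool_def sum.If_cases)
  also have "\<dots> = (\<Sum>j<h + 1. level_size (f 1) c j)"
    using sum_levels[of f 0 "h + 1"] lev by (simp add: Suc_leI)
  finally have card: "int (card W) = (\<Sum>j<h + 1. level_size (f 1) c j)" .
  have "(\<Sum>j<h. \<bar>c j\<bar>) \<le> (\<Sum>j<h. \<Sum>v = 2 ^ (j + 1)..<2 ^ (j + 2). \<bar>f v - f (v div 2)\<bar>)"
    by (rule sum_mono) (auto simp: c_def)
  also have "\<dots> = (\<Sum>v = 2..<2 ^ (h + 1). \<bar>f v - f (v div 2)\<bar>)"
    using sum_levels[of "\<lambda>v. \<bar>f v - f (v div 2)\<bar>" 1 h] by simp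
  also have "\<dots> = (\<Sum>v = 2..<2 ^ (h + 1). of_bool ((v \<in> W) \<noteq> (v div 2 \<in> W)))"
    by (rule sum.cong) (auto simp: f_def)
  also have "\<dots> = int (card (cut h W))"
    by (simp add: cut_def of_bool_def sum.If_cases Int_def)
  finally have "c \<in> bounded_seqs h b"
    using b by (auto simp: bounded_seqs_def c_def)
  with card show ?thesis by (auto simp: image_iff f_def)
qed

text \<open>The left side is polynomial in \<open>h\<close>, since \<open>b\<close> and
  \<open>M\<close> are fixed. Its first factor exceeds by one the bound on the number of sizes, its
  second is the block length for the pigeonhole argument.\<close>

lemma polynomial_less_power_two: "\<exists>h::nat. (2 * (2 * h + 1) ^ b + 1) * (M + 1) + 2 < (2::nat) ^ (h + 1)"
proof -
  have "\<forall>\<^sub>F h in sequentially. (2 * (2 * real h + 1) ^ b + 1) * (real M + 1) + 2 < 2 ^ (h + 1)"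
    by real_asymp
  then obtain h where "(2 * (2 * real h + 1) ^ b + 1) * (real M + 1) + 2 < 2 ^ (h + 1)"
    by (meson eventually_happens' sequentially_bot)
  then have "real ((2 * (2 * h + 1) ^ b + 1) * (M + 1) + 2) < real (2 ^ (h + 1))"
    by (simp add: algebra_simps)
  then show ?thesis by (metis of_nat_less_iff)
qed

lemma card_cut_gap:
  "\<exists>h s. s + M + 2 < (2 :: nat) ^ (h + 1) \<and>
    (\<forall>W \<subseteq> {1..<2 ^ (h + 1)}. s \<le> card W \<longrightarrow> card W \<le> s + M \<longrightarrow> b < card (cut h W))"
proof -
  obtain h where h: "(2 * (2 * h + 1) ^ b + 1) * (M + 1) + 2 < (2::nat) ^ (h + 1)"
    using polynomial_less_power_two by blast
  define Z where "Z = (\<lambda>(a, c). \<Sum>j<h + 1. level_size a c j) ` ({0, 1} \<times> bounded_seqs h b)"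
  have fin: "finite Z" using card_bounded_seqs by (simp add: Z_def)
  \<comment> \<open>\<open>nat\<close> may identify elements of \<open>Z\<close> that are not
    positive, which only lowers the count; sizes of sets are nonnegative and survive it.\<close>
  have "card (nat ` Z) \<le> card Z" using fin by (rule card_image_le)
  also have "\<dots> \<le> card ({0, 1 :: int} \<times> bounded_seqs h b)"
    using card_bounded_seqs unfolding Z_def by (intro card_image_le) auto
  also have "\<dots> = 2 * card (bounded_seqs h b)" by (simp add: card_cartesian_product)
  also have "\<dots> \<le> 2 * (2 * h + 1) ^ b" using card_bounded_seqs by (intro mult_le_mono2) blast
  finally have "card (nat ` Z) < 2 * (2 * h + 1) ^ b + 1" by simp
  then obtain s where s: "s + M < (2 * (2 * h + 1) ^ b + 1) * (M + 1)"
    "\<And>a. s \<le> a \<Longrightarrow> a \<le> s + M \<Longrightarrow> a \<notin> nat ` Z"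
    using gap_exists[of "nat ` Z"] fin by blast
  show ?thesis
  proof (intro exI conjI allI impI)
    show "s + M + 2 < 2 ^ (h + 1)" using s(1) h by linarith
    fix W :: "nat set" assume W: "W \<subseteq> {1..<2 ^ (h + 1)}" "s \<le> card W" "card W \<le> s + M"
    show "b < card (cut h W)"
    proof (rule ccontr)
      assume "\<not> b < card (cut h W)"
      then have "int (card W) \<in> Z" unfolding Z_def using card_levels_of_cut[OF W(1)] by simp
      then have "card W \<in> nat ` Z" by (metis image_eqI nat_int)
      then show False using s(2) W by blast
    qed
  qed
qed

subsection \<open>The complete binary tree\<close>

text \<open>Heap numbering: the root is 1 and the children of \<open>v\<close> are \<open>2 * v\<close> and \<open>2 * v + 1\<close>.\<close>
definition btree :: "nat \<Rightarrow> (nat, nat \<times> nat) pre_digraph" where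
  "btree h = \<lparr>verts = {1..<2 ^ (h + 1)},
     arcs = {(u, v). u \<in> {1..<2 ^ (h + 1)} \<and> v \<in> {1..<2 ^ (h + 1)} \<and> (u = v div 2 \<or> v = u div 2)},
     tail = fst, head = snd\<rparr>"

lemma verts_btree [simp]: "verts (btree h) = {1..<2 ^ (h + 1)}"
  by (simp add: btree_def)

lemma btree_adj_iff:
  "u \<rightarrow>\<^bsub>btree h\<^esub> v \<longleftrightarrow> u \<in> verts (btree h) \<and> v \<in> verts (btree h) \<and> (u = v div 2 \<or> v = u div 2)"
  by (auto simp: arcs_ends_def arc_to_ends_def btree_def image_iff)

lemma btree_arcs_iff: "e \<in> arcs (btree h) \<longleftrightarrow> fst e \<rightarrow>\<^bsub>btree h\<^esub> snd e"
  unfolding btree_adj_iff by (cases e) (auto simp: btree_def)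

lemma graph_btree: "graph (btree h)"
proof
  have "arcs (btree h) \<subseteq> {1..<2 ^ (h + 1)} \<times> {1..<2 ^ (h + 1)}" by (auto simp: btree_def)
  then show "finite (arcs (btree h))" by (rule finite_subset) simp
  show "Digraph.symmetric (btree h)"
    unfolding Digraph.symmetric_def by (auto simp: sym_def btree_adj_iff)
qed (auto simp: btree_def arc_to_ends_def)

lemma connected_btree: "Digraph_Component.connected (btree h)"
proof -
  interpret graph "btree h" by (rule graph_btree)
  have root: "v \<rightarrow>\<^sup>*\<^bsub>btree h\<^esub> 1" if "v \<in> verts (btree h)" for v
    using that
  proof (induction v rule: less_induct)
    case (less v)
    show ?case
    proof (cases "v = 1")
      case False
      then have v: "v div 2 \<in> verts (btree h)" "v div 2 < v" "v \<rightarrow>\<^bsub>btree h\<^esub> (v div 2)"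
        using less.prems by (auto simp: btree_adj_iff)
      show ?thesis using adj_reachable_trans[OF v(3) less.IH[OF v(2,1)]] .
    qed (use less.prems in simp)
  qed
  have "u \<rightarrow>\<^sup>*\<^bsub>btree h\<^esub> v" if "u \<in> verts (btree h)" "v \<in> verts (btree h)" for u v
    using root[OF that(1)] symmetric_reachable[OF sym_arcs root[OF that(2)]] by (rule reachable_trans)
  moreover have "1 \<in> verts (btree h)" using one_less_power[of "2::nat" "h + 1"] by simp
  ultimately have "strongly_connected (btree h)"
    by (auto simp only: strongly_connected_def)
  then show ?thesis
    unfolding Digraph_Component.connected_def strongly_connected_def
    by (simp add: reachable_mk_symmetric_eq[OF sym_arcs])
qed

lemma awalk_verts_adj:
  assumes "wf_digraph G" "pre_digraph.awalk G u p v" "i < length p"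
  shows "pre_digraph.awalk_verts G u p ! i \<rightarrow>\<^bsub>G\<^esub> pre_digraph.awalk_verts G u p ! Suc i"
  using assms(2,3)
proof (induction p arbitrary: u i)
  case (Cons e p)
  interpret wf_digraph G by fact
  have *: "awalk (head G e) p v" "u \<rightarrow>\<^bsub>G\<^esub> head G e" "tail G e = u"
    using Cons.prems(1) by (auto simp: awalk_Cons_iff intro: in_arcs_imp_in_arcs_ends)
  have hd: "awalk_verts (head G e) p ! 0 = head G e"
    using *(1) by (cases p) (auto simp: awalk_Cons_iff)
  show ?case
  proof (cases i)
    case 0
    then show ?thesis using * hd by simp
  next
    case (Suc j)
    then show ?thesis using Cons.IH[OF *(1), of j] Cons.prems(2) by simp
  qed
qed simp

text \<open>Both neighbours of the largest vertex on a cycle are its parent.\<close>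
lemma btree_no_cycle:
  assumes "pre_digraph.cycle (btree h) p"
  shows "length p < 3"
proof (rule ccontr)
  assume "\<not> length p < 3"
  then have n3: "3 \<le> length p" by simp
  interpret graph "btree h" by (rule graph_btree)
  obtain u where u: "awalk u p u" "distinct (tl (awalk_verts u p))"
    using assms by (auto simp: cycle_def)
  define n where "n = length p"
  define x where "x i = awalk_verts u p ! i" for i
  have len: "length (awalk_verts u p) = Suc n" by (simp add: length_awalk_verts n_def)
  have adj: "x i \<rightarrow>\<^bsub>btree h\<^esub> x (Suc i)" if "i < n" for i
    unfolding x_def using awalk_verts_adj[OF wf_digraph u(1)] that by (simp add: n_def)
  have "x 0 = u" "x n = u"
    using awalkE[OF u(1)] len unfolding x_def
    by (metis awalk_verts_non_Nil hd_conv_nth, metis awalk_verts_non_Nil diff_Suc_1 last_conv_nth)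
  then have closed: "x 0 = x n" by simp
  \<comment> \<open>Only the tail of the vertex list is distinct, because the start
    \<open>x 0\<close> recurs as \<open>x n\<close>; hence the index range starts at 1.\<close>
  have inj: "i = j" if "x i = x j" "i \<in> {1..n}" "j \<in> {1..n}" for i j
  proof -
    have "tl (awalk_verts u p) ! (i - 1) = tl (awalk_verts u p) ! (j - 1)"
      using that len by (cases i; cases j) (auto simp: nth_tl x_def)
    then have "i - 1 = j - 1"
      using nth_eq_iff_index_eq[OF u(2), of "i - 1" "j - 1"] that len by auto
    then show ?thesis using that by auto
  qed
  have parent: "w = v div 2" if "w \<le> v" "w \<rightarrow>\<^bsub>btree h\<^esub> v \<or> v \<rightarrow>\<^bsub>btree h\<^esub> w" for v w
    using that by (auto simp: btree_adj_iff)
  have fin: "finite (x ` {1..n})" "x ` {1..n} \<noteq> {}" using n3 by (auto simp: n_def)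
  obtain i where i: "i \<in> {1..n}" "x i = Max (x ` {1..n})" using Max_in[OF fin] by auto
  have max1: "x j \<le> x i" if "j \<in> {1..n}" for j using that i fin by simp
  have max: "x j \<le> x i" if "j \<le> n" for j
    using max1[of j] max1[of n] closed that n3 by (cases j) (auto simp: n_def)
  have pred: "x (i - 1) = x i div 2"
    using adj[of "i - 1"] i max by (intro parent) auto
  show False
  proof (cases "i = n")
    case True
    have "x (Suc 0) = x i div 2"
      using adj[of 0] closed True max[of "Suc 0"] n3 unfolding n_def by (intro parent) (auto simp del: length_greater_0_conv)
    then have "n - 1 = Suc 0" using pred True inj[of "n - 1" "Suc 0"] n3 by (auto simp: n_def)
    then show False using n3 by (simp add: n_def)
  next
    case False
    then have "x (Suc i) = x i div 2"
      using adj[of i] max[of "Suc i"] i by (intro parent) auto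
    then have eq: "x (i - 1) = x (Suc i)" using pred by simp
    show False
    proof (cases "i = 1")
      case True
      \<comment> \<open>Here the predecessor is \<open>x 0 = x n\<close>, so injectivity forces
        \<open>n = 2\<close>.\<close>
      then show False using eq closed inj[of n "Suc i"] n3 by (auto simp: n_def)
    next
      case False
      then have "i - 1 \<in> {1..n}" "Suc i \<in> {1..n}" using i(1) \<open>i \<noteq> n\<close> by auto
      from inj[OF eq this] show False by simp
    qed
  qed
qed

lemma undirected_tree_btree: "undirected_tree (btree h)"
  using graph_btree connected_btree btree_no_cycle unfolding undirected_tree_def
  by (metis not_less)

text \<open>Every edge of the cut has one end in \<open>W\<close>, and that end lies in the inner
  boundary. A vertex is an end of at most three edges, represented by itself and by its two
  children.\<close>

lemma card_cut_le:
  assumes W: "W \<subseteq> verts (btree h)"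
  shows "card (cut h W) \<le> 3 * card (inner_boundary (btree h) W)"
proof -
  let ?B = "inner_boundary (btree h) W"
  have fin: "finite ?B" using W finite_subset by (fastforce simp: inner_boundary_def)
  have "cut h W \<subseteq> ?B \<union> ((\<lambda>v. 2 * v) ` ?B \<union> (\<lambda>v. 2 * v + 1) ` ?B)"
  proof
    fix v assume v: "v \<in> cut h W"
    then have vv: "v \<in> verts (btree h)" "v div 2 \<in> verts (btree h)" by (auto simp: cut_def)
    show "v \<in> ?B \<union> ((\<lambda>v. 2 * v) ` ?B \<union> (\<lambda>v. 2 * v + 1) ` ?B)"
    proof (cases "v \<in> W")
      case True
      then have "v \<in> ?B" using v vv by (auto simp: cut_def inner_boundary_def btree_adj_iff)
      then show ?thesis by blast
    next
      case False
      then have "v div 2 \<in> ?B"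
        using v vv unfolding cut_def inner_boundary_def btree_adj_iff by blast
      moreover have "v = 2 * (v div 2) \<or> v = 2 * (v div 2) + 1" by presburger
      ultimately show ?thesis by blast
    qed
  qed
  then have "card (cut h W) \<le> card (?B \<union> ((\<lambda>v. 2 * v) ` ?B \<union> (\<lambda>v. 2 * v + 1) ` ?B))"
    using fin by (intro card_mono) auto
  also have "\<dots> \<le> card ?B + (card ((\<lambda>v. 2 * v) ` ?B) + card ((\<lambda>v. 2 * v + 1) ` ?B))"
    by (meson add_left_mono card_Un_le le_trans)
  also have "\<dots> \<le> card ?B + (card ?B + card ?B)"
    using fin by (intro add_mono card_image_le) auto
  finally show ?thesis by simp
qed

section \<open>Sizes of balls\<close>

lemma gdist_le_imp_awalk:
  assumes "wf_digraph G" "gdist G u v \<le> ereal (real k)"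
  shows "\<exists>p. pre_digraph.awalk G u p v \<and> length p \<le> k"
proof (rule ccontr)
  interpret wf_digraph G by fact
  assume none: "\<not> ?thesis"
  have cost: "awalk_cost (\<lambda>_. 1) p = real (length p)" for p
    by (induction p) auto
  have "ereal (real k + 1) \<le> gdist G u v"
    unfolding gdist_def \<mu>_def
  proof (rule INF_greatest)
    fix p assume "p \<in> {p. awalk u p v}"
    then have "k < length p" using none by (auto simp: not_le)
    then show "ereal (real k + 1) \<le> ereal (awalk_cost (\<lambda>_. 1) p)" by (simp add: cost)
  qed
  also have "\<dots> \<le> ereal (real k)" by (rule assms)
  finally show False by simp
qed

text \<open>A superset of the ball that ignores the limits of the tree: 0 and numbers beyond the
  last level may occur. Four options per step give the bound \<open>4 ^ k\<close>.\<close>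

primrec heap_ball :: "nat \<Rightarrow> nat \<Rightarrow> nat set" where
  "heap_ball u 0 = {u}"
| "heap_ball u (Suc k) = (\<Union>v\<in>heap_ball u k. {v, v div 2, 2 * v, 2 * v + 1})"

lemma card_heap_ball: "finite (heap_ball u k) \<and> card (heap_ball u k) \<le> 4 ^ k"
proof (induction k)
  case (Suc k)
  have "card (heap_ball u (Suc k)) \<le> (\<Sum>v\<in>heap_ball u k. card {v, v div 2, 2 * v, 2 * v + 1})"
    using Suc by (simp add: card_UN_le)
  also have "\<dots> \<le> (\<Sum>v\<in>heap_ball u k. 4)"
    by (intro sum_mono) (simp add: card_insert_if)
  also have "\<dots> \<le> 4 ^ Suc k" using Suc by simp
  finally show ?case using Suc by simp
qed simp

text \<open>\<open>heap_ball\<close> grows at its outer end, while induction on a walk removes the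
  first arc; this adds a step at the centre instead.\<close>

lemma heap_ball_shift:
  "v \<in> {u, u div 2, 2 * u, 2 * u + 1} \<Longrightarrow> heap_ball v k \<subseteq> heap_ball u (Suc k)"
proof (induction k)
  case (Suc k)
  then show ?case
    unfolding heap_ball.simps(2)[of v k] heap_ball.simps(2)[of u "Suc k"] by (intro UN_mono) auto
qed auto

lemma heap_ball_mono: "j \<le> k \<Longrightarrow> heap_ball u j \<subseteq> heap_ball u k"
  by (induction k rule: dec_induct) auto

lemma awalk_heap_ball: "pre_digraph.awalk (btree h) u p v \<Longrightarrow> v \<in> heap_ball u (length p)"
proof (induction p arbitrary: u)
  case Nil
  then show ?case by (simp add: pre_digraph.awalk_def pre_digraph.cas.simps)
next
  case (Cons e p)
  interpret graph "btree h" by (rule graph_btree)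
  have *: "awalk (snd e) p v" "u \<rightarrow>\<^bsub>btree h\<^esub> snd e"
    using Cons.prems by (auto simp: awalk_Cons_iff btree_arcs_iff) (auto simp: btree_def)
  have "snd e \<in> {u, u div 2, 2 * u, 2 * u + 1}"
    using *(2) unfolding btree_adj_iff by (auto; presburger)
  from heap_ball_shift[OF this, of "length p"] show ?case using Cons.IH[OF *(1)] by auto
qed

lemma card_ball_btree: "card {x \<in> verts (btree h). gdist (btree h) u x \<le> ereal (real k)} \<le> 4 ^ k"
proof -
  interpret graph "btree h" by (rule graph_btree)
  have "{x \<in> verts (btree h). gdist (btree h) u x \<le> ereal (real k)} \<subseteq> heap_ball u k"
    using gdist_le_imp_awalk[OF wf_digraph] awalk_heap_ball heap_ball_mono by blast
  then show ?thesis using card_heap_ball card_mono le_trans by meson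
qed

theorem theorem6:
  fixes k d :: nat
  assumes "0 < d"
  shows "\<exists>T :: (nat, nat \<times> nat) pre_digraph. undirected_tree T \<and> localization_number k T > d"
proof -
  define M where "M = d * 4 ^ k"
  \<comment> \<open>The factor 3 pays for the at most three cut edges at each vertex of the inner
    boundary.\<close>
  obtain h s where large: "s + M + 2 < (2 :: nat) ^ (h + 1)"
    and gap: "\<And>W. W \<subseteq> {1..<2 ^ (h + 1)} \<Longrightarrow> s \<le> card W \<Longrightarrow> card W \<le> s + M \<Longrightarrow>
      3 * M < card (cut h W)"
    using card_cut_gap[of M "3 * M"] by metis
  \<comment> \<open>The least winning number exceeds \<open>d\<close> only if every positive
    \<open>m \<le> d\<close> loses; the same \<open>h\<close> and \<open>s\<close> serve them all
    because \<open>m * 4 ^ k \<le> M\<close>.\<close>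
  have lose: "\<not> cops_win k (btree h) m" if "m \<le> d" for m
  proof (rule not_cops_win_isoperimetric)
    have mM: "m * 4 ^ k \<le> M" using that by (simp add: M_def)
    show "s + m * 4 ^ k + 2 \<le> card (verts (btree h))" using mM large by simp
    show "finite (verts (btree h))" by simp
    show "card {x \<in> verts (btree h). gdist (btree h) u x \<le> ereal (real k)} \<le> 4 ^ k" for u
      by (rule card_ball_btree)
    fix W assume W: "W \<subseteq> verts (btree h)" "s \<le> card W" "card W \<le> s + m * 4 ^ k"
    then have "3 * M < 3 * card (inner_boundary (btree h) W)"
      using gap[of W] card_cut_le[OF W(1)] mM by simp
    then show "m * 4 ^ k \<le> card (inner_boundary (btree h) W)" using mM by simp
  qed
  let ?P = "\<lambda>m. 0 < m \<and> cops_win k (btree h) m"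
  \<comment> \<open>The value of \<open>LEAST\<close> is known to satisfy its predicate once some
    number does; one cop on each vertex provides it.\<close>
  have "?P (card (verts (btree h)))"
    using cops_win_card_verts[OF graph_btree] large by simp
  then have "?P (localization_number k (btree h))"
    unfolding localization_number_def by (rule LeastI[of ?P])
  then have "localization_number k (btree h) > d"
    using lose[of "localization_number k (btree h)"] by linarith
  with undirected_tree_btree show ?thesis by (intro exI conjI)
qed

end
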